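(* Let $m,n,p,q\in\mathbb{N}_0$ be such that $0\le m\le q$, $0\le n\le p$, let $a_i,b_j\in\mathbb{R}$ and $\alpha_i,\beta_j\in(0,\infty)$ for $i=1,\dots,p$, $j=1,\dots,q$, and let $\gamma\in\mathbb{R}$. Suppose that the poles $b_{jl}=-\frac{b_j+l}{\beta_j}$ ($j=1,\dots,m$, $l\in\mathbb{N}_0$) are on the left of the contour $\mathcal{L}_{\mathrm{i}\gamma\infty}$ and the poles $a_{ik}=\frac{1-a_i+k}{\alpha_i}$ ($i=1,\dots,n$, $k\in\mathbb{N}_0$) are on the right of $\mathcal{L}_{\mathrm{i}\gamma\infty}$. Then, for $s=\gamma+R\mathrm{e}^{\mathrm{i}\theta}$ with $\theta\in(-\pi,\pi)\setminus\{0\}$, $R>0$, and for $z\in\mathbb{C}\setminus\{0\}$, the following asymptotic formula holds: $$|\mathcal{H}^{m,n}_{p,q}(s)z^{-s}|\sim C\exp\big(\Upsilon_1R\,\mathrm{Log}(R)-\Upsilon_2R+\Upsilon_3\mathrm{Log}(R)\big)\quad\text{as }R\to\infty,$$ where $$\Upsilon_1=\cos(\theta)\Delta,\qquad \Upsilon_2=\cos(\theta)\,\mathrm{Log}\big(\exp(\Delta)|z|/\delta\big)+\sin(\theta)\Theta,\qquad \Upsilon_3=\mu+\gamma\Delta,$$ $$\Theta=a_1^*\theta-a_2^*\,\mathrm{sign}(\theta)(|\theta|-\pi)+\arg(z),$$ $$C=|z|^{-\gamma}(2\pi)^{m+n-(p+q)/2}\,\frac{\prod_{j=1}^q\beta_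j^{b_j+\beta_j\gamma-1/2}}{\prod_{i=1}^p\alpha_i^{a_i+\alpha_i\gamma-1/2}}.$$
   Context: For the given parameters put $$\mathcal{H}^{m,n}_{p,q}(s)=\frac{\prod_{j=1}^{m}\Gamma(b_j+s\beta_j)\prod_{i=1}^{n}\Gamma(1-a_i-s\alpha_i)}{\prod_{i=n+1}^{p}\Gamma(a_i+s\alpha_i)\prod_{j=m+1}^{q}\Gamma(1-b_j-s\beta_j)},$$ with empty products equal to $1$ and empty sums equal to $0$. Here $z^{-s}=\exp[-s(\mathrm{Log}(|z|)+\mathrm{i}\arg(z))]$, where $\mathrm{Log}$ is the natural logarithm and $\arg(z)\in(-\pi,\pi]$ is the principal value. The contour $\mathcal{L}_{\mathrm{i}\gamma\infty}$ starts at $\gamma-\mathrm{i}\infty$ and terminates at $\gamma+\mathrm{i}\infty$. The constants are $a_1^*=\sum_{j=1}^m\beta_j-\sum_{i=n+1}^p\alpha_i$, $a_2^*=\sum_{i=1}^n\alpha_i-\sum_{j=m+1}^q\beta_j$, $\Delta=a_1^*-a_2^*=\sum_{j=1}^q\beta_j-\sum_{i=1}^p\alpha_i$, $\delta=\prod_{j=1}^q\beta_j^{\beta_j}\prod_{i=1}^p\alpha_i^{-\alpha_i}$, $\mu=\sum_{j=1}^qb_j-\sum_{i=1}^pa_i+(p-q)/2$.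
   Formalization: In Θ the term +arg(z) is replaced by −arg(z): with the stated convention for z^{-s} the printed sign is false whenever arg(z)≠0 (e.g. m=n=p=q=0, γ=0, z=i, θ=π/2); for arg(z)=0 the two agree. *)

theory Defs
  imports "HOL-Analysis.Analysis"
begin

text \<open>
  Parameters are families \<open>a \<alpha> b \<beta> :: nat \<Rightarrow> real\<close>, of which only \<open>a i, \<alpha> i\<close> for \<open>1 \<le> i \<le> p\<close> and
  \<open>b j, \<beta> j\<close> for \<open>1 \<le> j \<le> q\<close> are used.

  The library's \<open>Gamma\<close> is \<open>0\<close> at its poles and \<open>x / 0 = 0\<close>. A pole of a denominator factor
  therefore makes \<open>H_kernel\<close> vanish, in agreement with the convention \<open>1 / \<Gamma> = 0\<close> there.
\<close>

definition H_kernel ::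
  "nat \<Rightarrow> nat \<Rightarrow> nat \<Rightarrow> nat \<Rightarrow> (nat \<Rightarrow> real) \<Rightarrow> (nat \<Rightarrow> real) \<Rightarrow> (nat \<Rightarrow> real) \<Rightarrow> (nat \<Rightarrow> real)
    \<Rightarrow> complex \<Rightarrow> complex"
  where
  "H_kernel m n p q a \<alpha> b \<beta> s =
     ((\<Prod>j=1..m. Gamma (of_real (b j) + s * of_real (\<beta> j))) *
      (\<Prod>i=1..n. Gamma (1 - of_real (a i) - s * of_real (\<alpha> i)))) /
     ((\<Prod>i=n+1..p. Gamma (of_real (a i) + s * of_real (\<alpha> i))) *
      (\<Prod>j=m+1..q. Gamma (1 - of_real (b j) - s * of_real (\<beta> j))))"

definition a1_star :: "nat \<Rightarrow> nat \<Rightarrow> nat \<Rightarrow> (nat \<Rightarrow> real) \<Rightarrow> (nat \<Rightarrow> real) \<Rightarrow> real" where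
  "a1_star m n p \<alpha> \<beta> = (\<Sum>j=1..m. \<beta> j) - (\<Sum>i=n+1..p. \<alpha> i)"

definition a2_star :: "nat \<Rightarrow> nat \<Rightarrow> nat \<Rightarrow> (nat \<Rightarrow> real) \<Rightarrow> (nat \<Rightarrow> real) \<Rightarrow> real" where
  "a2_star m n q \<alpha> \<beta> = (\<Sum>i=1..n. \<alpha> i) - (\<Sum>j=m+1..q. \<beta> j)"

definition H_Delta :: "nat \<Rightarrow> nat \<Rightarrow> (nat \<Rightarrow> real) \<Rightarrow> (nat \<Rightarrow> real) \<Rightarrow> real" where
  "H_Delta p q \<alpha> \<beta> = (\<Sum>j=1..q. \<beta> j) - (\<Sum>i=1..p. \<alpha> i)"

lemma H_Delta_eq:
  assumes "m \<le> q" "n \<le> p"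
  shows "H_Delta p q \<alpha> \<beta> = a1_star m n p \<alpha> \<beta> - a2_star m n q \<alpha> \<beta>"
proof -
  have "(\<Sum>j=1..q. \<beta> j) = (\<Sum>j=1..m. \<beta> j) + (\<Sum>j=m+1..q. \<beta> j)"
    using sum.ub_add_nat[of 1 m \<beta> "q - m"] assms by simp
  moreover have "(\<Sum>i=1..p. \<alpha> i) = (\<Sum>i=1..n. \<alpha> i) + (\<Sum>i=n+1..p. \<alpha> i)"
    using sum.ub_add_nat[of 1 n \<alpha> "p - n"] assms by simp
  ultimately show ?thesis
    by (simp add: H_Delta_def a1_star_def a2_star_def)
qed

definition H_delta :: "nat \<Rightarrow> nat \<Rightarrow> (nat \<Rightarrow> real) \<Rightarrow> (nat \<Rightarrow> real) \<Rightarrow> real" where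
  "H_delta p q \<alpha> \<beta> = (\<Prod>j=1..q. \<beta> j powr \<beta> j) * (\<Prod>i=1..p. \<alpha> i powr (- \<alpha> i))"

definition H_mu :: "nat \<Rightarrow> nat \<Rightarrow> (nat \<Rightarrow> real) \<Rightarrow> (nat \<Rightarrow> real) \<Rightarrow> real" where
  "H_mu p q a b = (\<Sum>j=1..q. b j) - (\<Sum>i=1..p. a i) + (real p - real q) / 2"

text \<open>
  A contour from \<open>\<gamma> - \<i>\<infinity>\<close> to \<open>\<gamma> + \<i>\<infinity>\<close> need not be the straight line \<open>Re s = \<gamma>\<close>. It is modelled as
  a simple, locally piecewise \<open>C\<^sup>1\<close> curve parametrised by the real line. Its real part is bounded,
  so a point off the curve lies to its left (right) iff its component in the complement of
  the curve contains a left (right) half-plane.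
\<close>

definition vertical_contour :: "real \<Rightarrow> (real \<Rightarrow> complex) \<Rightarrow> bool" where
  "vertical_contour \<gamma> L \<longleftrightarrow>
     inj L \<and>
     (\<forall>u v. L piecewise_C1_differentiable_on {u..v}) \<and>
     ((\<lambda>t. Re (L t)) \<longlongrightarrow> \<gamma>) at_bot \<and> filterlim (\<lambda>t. Im (L t)) at_bot at_bot \<and>
     ((\<lambda>t. Re (L t)) \<longlongrightarrow> \<gamma>) at_top \<and> filterlim (\<lambda>t. Im (L t)) at_top at_top"

definition left_of_contour :: "(real \<Rightarrow> complex) \<Rightarrow> complex set" where
  "left_of_contour L =
     {w. \<exists>K::real. {u. Re u < K} \<subseteq> connected_component_set (- range L) w}"

definition right_of_contour :: "(real \<Rightarrow> complex) \<Rightarrow> complex set" where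
  "right_of_contour L =
     {w. \<exists>K::real. {u. Re u > K} \<subseteq> connected_component_set (- range L) w}"

text \<open>The straight line is a contour, with the expected left-hand and right-hand sides.\<close>

lemma vertical_contour_line: "vertical_contour \<gamma> (\<lambda>t. Complex \<gamma> t)"
proof -
  have eq: "(\<lambda>t. Complex \<gamma> t) = (\<lambda>t. of_real \<gamma> + t *\<^sub>R \<i>)"
    by (auto simp: complex_eq_iff)
  have "(\<lambda>t. Complex \<gamma> t) piecewise_C1_differentiable_on {u..v}" for u v
    unfolding eq
    by (intro C1_differentiable_imp_piecewise)
       (auto simp: C1_differentiable_on_def intro!: exI[of _ "\<lambda>_. \<i>"] derivative_eq_intros)
  then show ?thesis
    by (auto simp: vertical_contour_def inj_def filterlim_ident)
qed

lemma left_of_contour_line: "left_of_contour (\<lambda>t. Complex \<gamma> t) = {w. Re w < \<gamma>}"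
proof (intro equalityI subsetI)
  have rng: "range (\<lambda>t. Complex \<gamma> t) = {w. Re w = \<gamma>}"
    by (auto simp: complex_eq_iff image_iff)
  fix w assume w: "w \<in> {w. Re w < \<gamma>}"
  have "{u. Re u < \<gamma>} \<subseteq> connected_component_set (- range (\<lambda>t. Complex \<gamma> t)) w"
    using w by (intro connected_component_maximal)
      (auto simp: rng intro!: convex_connected convex_halfspace_Re_lt)
  then show "w \<in> left_of_contour (\<lambda>t. Complex \<gamma> t)"
    by (auto simp: left_of_contour_def)
next
  have rng: "range (\<lambda>t. Complex \<gamma> t) = {w. Re w = \<gamma>}"
    by (auto simp: complex_eq_iff image_iff)
  fix w assume "w \<in> left_of_contour (\<lambda>t. Complex \<gamma> t)"
  then obtain K where K: "{u. Re u < K} \<subseteq> connected_component_set (- range (\<lambda>t. Complex \<gamma> t)) w"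
    by (auto simp: left_of_contour_def)
  define S where "S = connected_component_set (- range (\<lambda>t. Complex \<gamma> t)) w"
  define u where "u = Complex (min K \<gamma> - 1) 0"
  have u: "u \<in> S"
    unfolding S_def by (rule subsetD[OF K]) (auto simp: u_def)
  have wS: "w \<in> S"
    using u connected_component_in connected_component_refl unfolding S_def by fastforce
  have conn: "connected (Re ` S)"
    by (intro connected_continuous_image continuous_intros) (simp add: S_def)
  have "S \<subseteq> - {w. Re w = \<gamma>}"
    unfolding S_def rng by (rule connected_component_subset)
  then have no: "\<gamma> \<notin> Re ` S" by auto
  show "w \<in> {w. Re w < \<gamma>}"
  proof (rule ccontr)
    assume "w \<notin> {w. Re w < \<gamma>}"
    then have "\<gamma> \<in> {Re u..Re w}" by (auto simp: u_def)
    moreover have "{Re u..Re w} \<subseteq> Re ` S"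
      using connected_contains_Icc[OF conn] u wS by blast
    ultimately show False using no by blast
  qed
qed

lemma right_of_contour_line: "right_of_contour (\<lambda>t. Complex \<gamma> t) = {w. Re w > \<gamma>}"
proof (intro equalityI subsetI)
  have rng: "range (\<lambda>t. Complex \<gamma> t) = {w. Re w = \<gamma>}"
    by (auto simp: complex_eq_iff image_iff)
  fix w assume w: "w \<in> {w. Re w > \<gamma>}"
  have "{u. Re u > \<gamma>} \<subseteq> connected_component_set (- range (\<lambda>t. Complex \<gamma> t)) w"
    using w by (intro connected_component_maximal)
      (auto simp: rng intro!: convex_connected convex_halfspace_Re_gt)
  then show "w \<in> right_of_contour (\<lambda>t. Complex \<gamma> t)"
    by (auto simp: right_of_contour_def)
next
  have rng: "range (\<lambda>t. Complex \<gamma> t) = {w. Re w = \<gamma>}"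
    by (auto simp: complex_eq_iff image_iff)
  fix w assume "w \<in> right_of_contour (\<lambda>t. Complex \<gamma> t)"
  then obtain K where K: "{u. Re u > K} \<subseteq> connected_component_set (- range (\<lambda>t. Complex \<gamma> t)) w"
    by (auto simp: right_of_contour_def)
  define S where "S = connected_component_set (- range (\<lambda>t. Complex \<gamma> t)) w"
  define u where "u = Complex (max K \<gamma> + 1) 0"
  have u: "u \<in> S"
    unfolding S_def by (rule subsetD[OF K]) (auto simp: u_def)
  have wS: "w \<in> S"
    using u connected_component_in connected_component_refl unfolding S_def by fastforce
  have conn: "connected (Re ` S)"
    by (intro connected_continuous_image continuous_intros) (simp add: S_def)
  have "S \<subseteq> - {w. Re w = \<gamma>}"
    unfolding S_def rng by (rule connected_component_subset)
  then have no: "\<gamma> \<notin> Re ` S" by auto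
  show "w \<in> {w. Re w > \<gamma>}"
  proof (rule ccontr)
    assume "w \<notin> {w. Re w > \<gamma>}"
    then have "\<gamma> \<in> {Re w..Re u}" by (auto simp: u_def)
    moreover have "{Re w..Re u} \<subseteq> Re ` S"
      using connected_contains_Icc[OF conn] u wS by blast
    ultimately show False using no by blast
  qed
qed

text \<open>
  \<open>z powr (- s)\<close> is \<open>exp (- s * (ln \<bar>z\<bar> + \<i> * Arg z))\<close> with \<open>Arg z \<in> (-\<pi>, \<pi>]\<close>, for \<open>z \<noteq> 0\<close>.
  The lemma below computes its modulus along a ray. It forces the sign of \<open>Arg z\<close> in \<open>H_Theta\<close>:
  the source prints \<open>+ arg z\<close>, which contradicts its own convention for \<open>z\<^sup>-\<^sup>s\<close>
  already when all four products are empty (take \<open>z = \<i>\<close>, \<open>\<theta> = \<pi>/2\<close>, \<open>\<gamma> = 0\<close>: the modulus is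
  \<open>exp (\<pi> R / 2)\<close>, the printed right-hand side is \<open>exp (- \<pi> R / 2)\<close>).
\<close>

lemma powr_minus_eq_exp_Arg:
  fixes z s :: complex
  assumes "z \<noteq> 0"
  shows "z powr (- s) = exp (- s * (of_real (ln (cmod z)) + \<i> * of_real (Arg z)))"
  using assms by (simp add: powr_def Arg_eq_Im_Ln complex_eq_iff[of "Ln z"] flip: Re_Ln)
     (metis complex_eq)

lemma norm_powr_minus_ray:
  fixes z :: complex
  assumes "z \<noteq> 0"
  shows "cmod (z powr (- (of_real \<gamma> + of_real R * cis \<theta>))) =
           cmod z powr (- \<gamma>) * exp (- R * (cos \<theta> * ln (cmod z) + sin \<theta> * (- Arg z)))"
  using assms by (simp add: powr_minus_eq_exp_Arg powr_def algebra_simps Arg_eq_Im_Ln flip: exp_add)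

definition H_Theta ::
  "nat \<Rightarrow> nat \<Rightarrow> nat \<Rightarrow> nat \<Rightarrow> (nat \<Rightarrow> real) \<Rightarrow> (nat \<Rightarrow> real) \<Rightarrow> complex \<Rightarrow> real \<Rightarrow> real" where
  "H_Theta m n p q \<alpha> \<beta> z \<theta> =
     a1_star m n p \<alpha> \<beta> * \<theta> - a2_star m n q \<alpha> \<beta> * sgn \<theta> * (\<bar>\<theta>\<bar> - pi) - Arg z"

definition H_Upsilon1 ::
  "nat \<Rightarrow> nat \<Rightarrow> (nat \<Rightarrow> real) \<Rightarrow> (nat \<Rightarrow> real) \<Rightarrow> real \<Rightarrow> real" where
  "H_Upsilon1 p q \<alpha> \<beta> \<theta> = cos \<theta> * H_Delta p q \<alpha> \<beta>"

definition H_Upsilon2 ::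
  "nat \<Rightarrow> nat \<Rightarrow> nat \<Rightarrow> nat \<Rightarrow> (nat \<Rightarrow> real) \<Rightarrow> (nat \<Rightarrow> real) \<Rightarrow> complex \<Rightarrow> real \<Rightarrow> real" where
  "H_Upsilon2 m n p q \<alpha> \<beta> z \<theta> =
     cos \<theta> * ln (exp (H_Delta p q \<alpha> \<beta>) * cmod z / H_delta p q \<alpha> \<beta>)
       + sin \<theta> * H_Theta m n p q \<alpha> \<beta> z \<theta>"

definition H_Upsilon3 ::
  "nat \<Rightarrow> nat \<Rightarrow> (nat \<Rightarrow> real) \<Rightarrow> (nat \<Rightarrow> real) \<Rightarrow> (nat \<Rightarrow> real) \<Rightarrow> (nat \<Rightarrow> real) \<Rightarrow> real \<Rightarrow> real"
  where
  "H_Upsilon3 p q a \<alpha> b \<beta> \<gamma> = H_mu p q a b + \<gamma> * H_Delta p q \<alpha> \<beta>"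

definition H_const ::
  "nat \<Rightarrow> nat \<Rightarrow> nat \<Rightarrow> nat \<Rightarrow> (nat \<Rightarrow> real) \<Rightarrow> (nat \<Rightarrow> real) \<Rightarrow> (nat \<Rightarrow> real) \<Rightarrow> (nat \<Rightarrow> real)
    \<Rightarrow> real \<Rightarrow> complex \<Rightarrow> real"
  where
  "H_const m n p q a \<alpha> b \<beta> \<gamma> z =
     cmod z powr (- \<gamma>) * (2 * pi) powr (real m + real n - (real p + real q) / 2) *
     ((\<Prod>j=1..q. \<beta> j powr (b j + \<beta> j * \<gamma> - 1/2)) /
      (\<Prod>i=1..p. \<alpha> i powr (a i + \<alpha> i * \<gamma> - 1/2)))"

end

theory Submission
  imports Defs "HOL-Real_Asymp.Real_Asymp"
begin

text \<open>
  Every factor of the kernel is a Gamma function evaluated along a ray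
  \<open>\<rho> e\<^sup>i\<^sup>\<theta> + B\<close> with \<open>B\<close> real and \<open>\<bar>\<theta>\<bar> < \<pi>\<close>. For \<open>\<Gamma>(b + s \<beta>)\<close> this is immediate, with
  \<open>\<rho> = \<beta> R\<close> and \<open>B = b + \<beta> \<gamma>\<close>. For \<open>\<Gamma>(1 - a - s \<alpha>)\<close> the direction is \<open>- e\<^sup>i\<^sup>\<theta>\<close>, and because
  \<open>\<theta> \<noteq> 0\<close> its angle \<open>\<theta> - sgn \<theta> \<pi>\<close> again lies in \<open>(-\<pi>, \<pi>)\<close>. So the theorem is Stirling's formula
  along rays (\<open>cmod_Gamma_ray_asymp_equiv\<close>), where the modulus of \<open>\<Gamma>\<close> is asymptotically
  \<open>\<surd>(2 \<pi>) exp ((\<rho> cos \<theta> + B - 1/2) ln \<rho> - (cos \<theta> + \<theta> sin \<theta>) \<rho>)\<close>,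
  applied to each factor, followed by collecting exponents. The logarithm of a reflected factor is
  minus that of the corresponding unreflected one, up to a term \<open>- \<pi> sgn \<theta> sin \<theta> \<alpha> R\<close>
  (\<open>cmod_Gamma_reflected_factor\<close>). Hence the position of a factor in the kernel influences only
  the total of these extra terms, which is a multiple of \<open>a\<^sub>2\<^sup>*\<close>, and the power of \<open>2 \<pi>\<close>.

  Stirling's formula comes from telescoping. With \<open>S z = (z - 1/2) Ln z - z\<close>, the defect
  \<open>g z = S (z + 1) - S z - Ln z\<close> is \<open>O(1 / \<bar>z\<bar>\<^sup>2)\<close> (\<open>norm_stirling_defect_le\<close>), so the Pochhammer
  products in Euler's limit for \<open>\<Gamma>\<close> telescope to \<open>\<Gamma>(z) = C exp (S z + (\<Sum>k. g (z + k)))\<close>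
  with a constant \<open>C\<close> (\<open>Gamma_eq_binet_const\<close>), and the sum tends to \<open>0\<close> away from the negative
  real axis. Legendre's duplication formula forces \<open>C = \<surd>(2 \<pi>)\<close> (\<open>exp_binet_const\<close>).
\<close>

section \<open>Sectors avoiding the negative real axis\<close>

text \<open>
  The quotient \<open>\<bar>z + t\<bar> / (\<bar>z\<bar> + t)\<close> over \<open>t \<ge> 0\<close> has minimum \<open>cos (Arg z / 2)\<close>, attained at
  \<open>t = \<bar>z\<bar>\<close>. For \<open>0 < \<kappa> \<le> 1\<close> the set below is therefore the sector
  \<open>\<bar>Arg z\<bar> \<le> 2 arccos \<kappa>\<close> without the origin. Written without angles, the condition is directly the
  estimate needed to sum \<open>1 / \<bar>z + k\<bar>\<^sup>2\<close>, and its stability under perturbations is a matter of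
  the triangle inequality.
\<close>

definition slit_cone :: "real \<Rightarrow> complex set" where
  "slit_cone \<kappa> = {z. z \<noteq> 0 \<and> (\<forall>t\<ge>0. \<kappa> * (cmod z + t) \<le> cmod (z + of_real t))}"

lemma slit_coneD:
  "z \<in> slit_cone \<kappa> \<Longrightarrow> t \<ge> 0 \<Longrightarrow> \<kappa> * (cmod z + t) \<le> cmod (z + of_real t)"
  by (simp add: slit_cone_def)

lemma slit_cone_not_nonpos_Reals:
  assumes "z \<in> slit_cone \<kappa>" "\<kappa> > 0"
  shows "z \<notin> \<real>\<^sub>\<le>\<^sub>0"
proof
  assume "z \<in> \<real>\<^sub>\<le>\<^sub>0"
  then obtain x where x: "z = of_real x" "x \<le> 0"
    by (auto elim!: nonpos_Reals_cases)
  moreover have "x \<noteq> 0" using assms x by (auto simp: slit_cone_def)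
  ultimately show False
    using slit_coneD[OF assms(1), of "- x"] assms(2)
    by (simp add: zero_le_mult_iff)
qed

lemma slit_cone_add_nonneg:
  assumes "z \<in> slit_cone \<kappa>" "\<kappa> > 0" "t \<ge> 0"
  shows "z + of_real t \<in> slit_cone \<kappa>"
proof -
  have "z + of_real t \<noteq> 0"
  proof -
    have "0 < \<kappa> * (cmod z + t)"
      using assms by (auto simp: slit_cone_def intro!: mult_pos_pos add_pos_nonneg)
    then show ?thesis using slit_coneD[OF assms(1,3)] by auto
  qed
  moreover have "\<kappa> * (cmod (z + of_real t) + u) \<le> cmod (z + of_real t + of_real u)" if "u \<ge> 0" for u
  proof -
    have "cmod (z + of_real t) \<le> cmod z + t"
      using norm_triangle_ineq[of z "of_real t"] assms(3) by simp
    then have "\<kappa> * (cmod (z + of_real t) + u) \<le> \<kappa> * (cmod z + (t + u))"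
      using assms(2) by simp
    also have "\<dots> \<le> cmod (z + of_real (t + u))"
      by (rule slit_coneD[OF assms(1)]) (use assms(3) that in simp)
    finally show ?thesis by (simp add: add.assoc)
  qed
  ultimately show ?thesis by (simp add: slit_cone_def)
qed

text \<open>
  The perturbation costs at most half of \<open>\<kappa> (\<bar>x\<bar> + t)\<close>, and it enlarges \<open>\<bar>x\<bar>\<close> at most by
  the factor \<open>3/2\<close>: together this is the factor \<open>3\<close> in the opening.
\<close>

lemma slit_cone_perturb:
  assumes "x \<in> slit_cone \<kappa>" "\<kappa> > 0" "2 * cmod u \<le> \<kappa> * cmod x"
  shows "x + u \<in> slit_cone (\<kappa> / 3)"
proof -
  have x0: "cmod x > 0" using assms by (auto simp: slit_cone_def)
  have k1: "\<kappa> \<le> 1" using slit_coneD[OF assms(1), of 0] x0 by simp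
  have "2 * cmod u \<le> 1 * cmod x"
    using assms(3) mult_right_mono[OF k1, of "cmod x"] by simp
  then have up: "cmod (x + u) \<le> 3/2 * cmod x" and "x + u \<noteq> 0"
    using norm_triangle_ineq[of x u] norm_triangle_ineq2[of x "- u"] x0
    by (auto simp: add_eq_0_iff2)
  moreover have "\<kappa> / 3 * (cmod (x + u) + t) \<le> cmod (x + u + of_real t)" if "t \<ge> 0" for t
  proof -
    have "\<kappa> / 3 * (cmod (x + u) + t) \<le> \<kappa> / 3 * (3/2 * (cmod x + t))"
      using up that assms(2) by (intro mult_left_mono) auto
    also have "\<dots> = \<kappa> * (cmod x + t) / 2" by simp
    also have "\<dots> \<le> \<kappa> * (cmod x + t) - cmod u"
    proof -
      have "\<kappa> * cmod x \<le> \<kappa> * (cmod x + t)" using that assms(2) by simp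
      then show ?thesis using assms(3) by linarith
    qed
    also have "\<dots> \<le> cmod (x + of_real t) - cmod u"
      using slit_coneD[OF assms(1) that] by simp
    also have "\<dots> \<le> cmod (x + u + of_real t)"
      using norm_triangle_ineq2[of "x + of_real t" "- u"] by (simp add: algebra_simps)
    finally show ?thesis .
  qed
  ultimately show ?thesis by (simp add: slit_cone_def)
qed

lemma ray_in_slit_cone:
  assumes "\<bar>\<theta>\<bar> < pi" "\<rho> > 0"
  shows "of_real \<rho> * cis \<theta> \<in> slit_cone (cos (\<theta> / 2))"
proof -
  have c: "cos \<theta> = 2 * (cos (\<theta>/2))\<^sup>2 - 1"
    using cos_double_cos[of "\<theta>/2"] by simp
  have "cos (\<theta>/2) * (\<rho> + t) \<le> cmod (of_real \<rho> * cis \<theta> + of_real t)" if t: "t \<ge> 0" for t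
  proof (rule power2_le_imp_le)
    have "(cmod (of_real \<rho> * cis \<theta> + of_real t))\<^sup>2 = (\<rho> * cos \<theta> + t)\<^sup>2 + (\<rho> * sin \<theta>)\<^sup>2"
      by (simp add: cmod_power2)
    also have "\<dots> = \<rho>\<^sup>2 * ((sin \<theta>)\<^sup>2 + (cos \<theta>)\<^sup>2) + t\<^sup>2 + 2 * \<rho> * t * cos \<theta>"
      by algebra
    also have "\<dots> = \<rho>\<^sup>2 + t\<^sup>2 + 2 * \<rho> * t * cos \<theta>" by simp
    finally have 1: "(cmod (of_real \<rho> * cis \<theta> + of_real t))\<^sup>2 = \<rho>\<^sup>2 + t\<^sup>2 + 2 * \<rho> * t * cos \<theta>" .
    have "(cmod (of_real \<rho> * cis \<theta> + of_real t))\<^sup>2 - (cos (\<theta>/2) * (\<rho> + t))\<^sup>2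
            = (1 - (cos (\<theta>/2))\<^sup>2) * (\<rho> - t)\<^sup>2"
      unfolding 1 c by algebra
    also have "\<dots> \<ge> 0"
      by (intro mult_nonneg_nonneg) (auto simp: abs_square_le_1)
    finally show "(cos (\<theta>/2) * (\<rho> + t))\<^sup>2 \<le> (cmod (of_real \<rho> * cis \<theta> + of_real t))\<^sup>2"
      by simp
  qed auto
  then show ?thesis
    using assms by (simp add: slit_cone_def norm_mult)
qed

section \<open>The remainder in Stirling's formula\<close>

definition stirling_exponent :: "complex \<Rightarrow> complex" where
  "stirling_exponent z = (z - 1/2) * Ln z - z"

definition stirling_defect :: "complex \<Rightarrow> complex" where
  "stirling_defect z = stirling_exponent (z + 1) - stirling_exponent z - Ln z"

text \<open>
  The defect is the value at \<open>x = 1\<close> of \<open>(z + x / 2) (Ln (z + x) - Ln z) - x\<close>. This function of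
  \<open>x\<close> vanishes to second order at \<open>0\<close>, and its second derivative is \<open>x / (2 (z + x)\<^sup>2)\<close>, so Taylor's
  theorem gives the quadratic decay. Working with a difference of logarithms avoids
  \<open>Ln (1 + 1 / z)\<close> and its branch.
\<close>

lemma norm_stirling_defect_le:
  assumes d: "d > 0"
    and seg: "\<And>t. 0 \<le> t \<Longrightarrow> t \<le> 1 \<Longrightarrow> d \<le> cmod (z + of_real t) \<and> z + of_real t \<notin> \<real>\<^sub>\<le>\<^sub>0"
  shows "cmod (stirling_defect z) \<le> 1 / (2 * d\<^sup>2)"
proof -
  define S where "S = closed_segment 0 (1::complex)"
  have S: "d \<le> cmod (z + x)" "z + x \<notin> \<real>\<^sub>\<le>\<^sub>0" "z + x \<noteq> 0" "cmod x \<le> 1" if "x \<in> S" for x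
  proof -
    obtain t where t: "x = of_real t" "0 \<le> t" "t \<le> 1"
      using \<open>x \<in> S\<close> by (auto simp: S_def closed_segment_def scaleR_conv_of_real)
    then show "d \<le> cmod (z + x)" "z + x \<notin> \<real>\<^sub>\<le>\<^sub>0" "cmod x \<le> 1"
      using seg[of t] by auto
    then show "z + x \<noteq> 0" by auto
  qed
  define f where "f = (\<lambda>(i::nat) x. if i = 0 then (z + x / 2) * (Ln (z + x) - Ln z) - x
     else if i = 1 then (Ln (z + x) - Ln z) / 2 - x / (2 * (z + x))
     else x / (2 * (z + x)\<^sup>2))"
  have der: "(f i has_field_derivative f (Suc i) x) (at x within S)" if "x \<in> S" and i: "i \<le> 1" for i x
  proof -
    define w where "w = z + x"
    have w: "w \<noteq> 0" and x: "x = w - z" using S[OF that(1)] by (auto simp: w_def)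
    have Ln': "((\<lambda>x. Ln (z + x)) has_field_derivative 1 / w) (at x within S)"
      using S[OF that(1)]
      by (auto intro!: derivative_eq_intros simp: w_def inverse_eq_divide)
    consider "i = 0" | "i = 1" using i by linarith
    then show ?thesis
    proof cases
      case 1
      have "((\<lambda>x. (z + x / 2) * (Ln (z + x) - Ln z) - x) has_field_derivative
              (0 + 1 / 2) * (Ln (z + x) - Ln z) + (1 / w - 0) * (z + x / 2) - 1) (at x within S)"
        by (intro DERIV_diff DERIV_mult DERIV_add DERIV_cdivide Ln' DERIV_ident DERIV_const)
      also have "(0 + 1 / 2) * (Ln (z + x) - Ln z) + (1 / w - 0) * (z + x / 2) - 1 = f 1 x"
        using w by (simp add: f_def x) (simp add: field_simps)
      finally show ?thesis by (simp add: f_def 1)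
    next
      case 2
      have "((\<lambda>x. (Ln (z + x) - Ln z) / 2 - x / (2 * (z + x))) has_field_derivative
              (1 / w - 0) / 2 - (1 * (2 * (z + x)) - x * (2 * (0 + 1)))
                / ((2 * (z + x)) * (2 * (z + x)))) (at x within S)"
        by (intro DERIV_diff DERIV_divide DERIV_cmult DERIV_add DERIV_cdivide Ln'
              DERIV_ident DERIV_const) (use w in \<open>simp add: w_def del: distrib_left_numeral\<close>)
      also have "(1 / w - 0) / 2 - (1 * (2 * (z + x)) - x * (2 * (0 + 1)))
                / ((2 * (z + x)) * (2 * (z + x))) = f 2 x"
        using w by (simp add: f_def x) (simp add: field_simps power2_eq_square)
      finally show ?thesis by (simp add: f_def 2)
    qed
  qed
  have bd: "cmod (f (Suc 1) x) \<le> 1 / (2 * d\<^sup>2)" if "x \<in> S" for x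
    using S[OF that] d
    by (auto simp: f_def norm_divide norm_mult norm_power intro!: frac_le power_mono mult_left_mono)
  have "cmod (f 0 1 - (\<Sum>i\<le>1. f i 0 * (1 - 0) ^ i / fact i)) \<le> 1 / (2 * d\<^sup>2) * cmod (1 - 0) ^ Suc 1 / fact 1"
    by (rule complex_Taylor[of S 1 f]) (use der bd in \<open>auto simp: S_def\<close>)
  moreover have "f 0 1 - (\<Sum>i\<le>1. f i 0 * (1 - 0) ^ i / fact i) = stirling_defect z"
    by (simp add: f_def stirling_defect_def stirling_exponent_def algebra_simps)
  ultimately show ?thesis by simp
qed

lemma norm_stirling_defect_slit_cone:
  assumes "z \<in> slit_cone \<kappa>" "\<kappa> > 0"
  shows "cmod (stirling_defect (z + of_nat k)) \<le> 1 / (2 * \<kappa>\<^sup>2) * (1 / (cmod z + real k)\<^sup>2)"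
proof -
  have z0: "cmod z > 0" using assms by (auto simp: slit_cone_def)
  have "cmod (stirling_defect (z + of_nat k)) \<le> 1 / (2 * (\<kappa> * (cmod z + real k))\<^sup>2)"
  proof (rule norm_stirling_defect_le)
    show "0 < \<kappa> * (cmod z + real k)" using assms(2) z0 by (simp add: add_pos_nonneg)
    fix t :: real assume t: "0 \<le> t" "t \<le> 1"
    have "\<kappa> * (cmod z + real k) \<le> \<kappa> * (cmod z + (real k + t))"
      using t assms(2) by simp
    also have "\<dots> \<le> cmod (z + of_real (real k + t))"
      by (rule slit_coneD[OF assms(1)]) (use t in simp)
    finally have "\<kappa> * (cmod z + real k) \<le> cmod (z + of_nat k + of_real t)"
      by (simp add: add.assoc)
    moreover have "z + of_real (real k + t) \<notin> \<real>\<^sub>\<le>\<^sub>0"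
      by (rule slit_cone_not_nonpos_Reals[OF slit_cone_add_nonneg[OF assms] assms(2)])
         (use t in simp)
    ultimately show "\<kappa> * (cmod z + real k) \<le> cmod (z + of_nat k + of_real t) \<and>
        z + of_nat k + of_real t \<notin> \<real>\<^sub>\<le>\<^sub>0" by (simp add: add.assoc)
  qed
  then show ?thesis by (simp add: power_mult_distrib mult.assoc)
qed

text \<open>
  Comparison with the telescoping series of \<open>1 / ((r + k) (r + k + 1))\<close>, whose terms are smaller by a
  factor of at most \<open>1 + 1 / r\<close>.
\<close>

lemma suminf_inverse_square_shift_le:
  fixes r :: real
  assumes "r > 0"
  shows "summable (\<lambda>k. 1 / (r + real k)\<^sup>2)" "(\<Sum>k. 1 / (r + real k)\<^sup>2) \<le> (1 + 1 / r) / r"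
proof -
  define v where "v = (\<lambda>k. 1 / (r + real k) - 1 / (r + real (Suc k)))"
  have "(\<lambda>k. 1 / (r + real k)) \<longlonglongrightarrow> 0" by real_asymp
  from telescope_sums'[OF this] have "v sums (1 / r)"
    by (simp add: v_def)
  then have s: "(\<lambda>k. (1 + 1 / r) * v k) sums ((1 + 1 / r) * (1 / r))"
    by (rule sums_mult)
  have le: "1 / (r + real k)\<^sup>2 \<le> (1 + 1 / r) * v k" for k
  proof -
    have p: "r + real k > 0" using assms by simp
    have v: "v k = 1 / ((r + real k) * (r + real k + 1))"
      using p by (simp add: v_def field_simps)
    have c: "r + real k + 1 \<le> (1 + 1 / r) * (r + real k)"
      using assms by (simp add: field_simps)
    have "1 / (r + real k)\<^sup>2 = (r + real k + 1) / ((r + real k)\<^sup>2 * (r + real k + 1))"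
      using p by simp
    also have "\<dots> \<le> ((1 + 1 / r) * (r + real k)) / ((r + real k)\<^sup>2 * (r + real k + 1))"
      using p c by (intro divide_right_mono) auto
    also have "\<dots> = (1 + 1 / r) * v k"
      using p by (simp add: v power2_eq_square)
    finally show ?thesis .
  qed
  show sm: "summable (\<lambda>k. 1 / (r + real k)\<^sup>2)"
    by (rule summable_comparison_test'[OF sums_summable[OF s], of 0]) (use le in auto)
  show "(\<Sum>k. 1 / (r + real k)\<^sup>2) \<le> (1 + 1 / r) / r"
    using suminf_le[OF le sm sums_summable[OF s]] sums_unique[OF s] by simp
qed

text \<open>
  Gudermann's series for Binet's function, a logarithm of
  \<open>\<Gamma>(z) / (\<surd>(2 \<pi>) z powr (z - 1/2) exp (- z))\<close>.
\<close>

definition binet_log :: "complex \<Rightarrow> complex" where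
  "binet_log z = (\<Sum>k. stirling_defect (z + of_nat k))"

lemma
  assumes "z \<in> slit_cone \<kappa>" "\<kappa> > 0"
  shows summable_stirling_defect: "summable (\<lambda>k. stirling_defect (z + of_nat k))"
    and norm_binet_log_le: "cmod (binet_log z) \<le> (1 + 1 / cmod z) / (2 * \<kappa>\<^sup>2 * cmod z)"
proof -
  have z0: "cmod z > 0" using assms by (auto simp: slit_cone_def)
  note bd = norm_stirling_defect_slit_cone[OF assms]
  note sq = suminf_inverse_square_shift_le[OF z0]
  have sm: "summable (\<lambda>k. 1 / (2 * \<kappa>\<^sup>2) * (1 / (cmod z + real k)\<^sup>2))"
    by (rule summable_mult[OF sq(1)])
  then have nsm: "summable (\<lambda>k. cmod (stirling_defect (z + of_nat k)))"
    by (rule summable_comparison_test'[where N = 0]) (use bd in auto)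
  then show "summable (\<lambda>k. stirling_defect (z + of_nat k))" by (rule summable_norm_cancel)
  have "cmod (binet_log z) \<le> (\<Sum>k. cmod (stirling_defect (z + of_nat k)))"
    unfolding binet_log_def by (rule summable_norm[OF nsm])
  also have "\<dots> \<le> (\<Sum>k. 1 / (2 * \<kappa>\<^sup>2) * (1 / (cmod z + real k)\<^sup>2))"
    by (rule suminf_le[OF bd nsm sm])
  also have "\<dots> = 1 / (2 * \<kappa>\<^sup>2) * (\<Sum>k. 1 / (cmod z + real k)\<^sup>2)"
    by (rule suminf_mult[OF sq(1)])
  also have "\<dots> \<le> 1 / (2 * \<kappa>\<^sup>2) * ((1 + 1 / cmod z) / cmod z)"
    by (rule mult_left_mono[OF sq(2)]) simp
  finally show "cmod (binet_log z) \<le> (1 + 1 / cmod z) / (2 * \<kappa>\<^sup>2 * cmod z)" by simp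
qed

lemma tendsto_binet_log:
  assumes "filterlim f at_infinity F" "eventually (\<lambda>x. f x \<in> slit_cone \<kappa>) F" "\<kappa> > 0"
  shows "((\<lambda>x. binet_log (f x)) \<longlongrightarrow> 0) F"
proof (rule Lim_null_comparison)
  show "eventually (\<lambda>x. cmod (binet_log (f x)) \<le>
          (1 + 1 / cmod (f x)) / (2 * \<kappa>\<^sup>2 * cmod (f x))) F"
    using assms(2) by eventually_elim (rule norm_binet_log_le[OF _ assms(3)])
  have "((\<lambda>r::real. (1 + 1 / r) / (2 * \<kappa>\<^sup>2 * r)) \<longlongrightarrow> 0) at_top"
    using assms(3) by real_asymp
  from filterlim_compose[OF this filterlim_compose[OF filterlim_norm_at_top assms(1)]]
  show "((\<lambda>x. (1 + 1 / cmod (f x)) / (2 * \<kappa>\<^sup>2 * cmod (f x))) \<longlongrightarrow> 0) F" .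
qed

section \<open>Shifting the argument of the Stirling exponent\<close>

lemma norm_Ln_add_le:
  assumes d: "d > 0"
    and seg: "\<And>v. v \<in> closed_segment 0 u \<Longrightarrow> d \<le> cmod (x + v) \<and> x + v \<notin> \<real>\<^sub>\<le>\<^sub>0"
  shows "cmod (Ln (x + u) - Ln x - u / x) \<le> (cmod u)\<^sup>2 / d\<^sup>2"
proof -
  define S where "S = closed_segment 0 u"
  define f where "f = (\<lambda>(i::nat) v. if i = 0 then Ln (x + v)
     else if i = 1 then 1 / (x + v) else - 1 / (x + v)\<^sup>2)"
  have S: "d \<le> cmod (x + v)" "x + v \<notin> \<real>\<^sub>\<le>\<^sub>0" "x + v \<noteq> 0" if "v \<in> S" for v
    using seg[of v] that by (auto simp: S_def)
  have der: "(f i has_field_derivative f (Suc i) v) (at v within S)" if "v \<in> S" and i: "i \<le> 1" for i v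
  proof -
    consider "i = 0" | "i = 1" using i by linarith
    then show ?thesis
      using S[OF that(1)]
      by cases (auto intro!: derivative_eq_intros simp: f_def power2_eq_square divide_inverse)
  qed
  have bd: "cmod (f (Suc 1) v) \<le> 1 / d\<^sup>2" if "v \<in> S" for v
    using S[OF that] d
    by (auto simp: f_def norm_divide norm_power intro!: frac_le power_mono)
  have "cmod (f 0 u - (\<Sum>i\<le>1. f i 0 * (u - 0) ^ i / fact i)) \<le> 1 / d\<^sup>2 * cmod (u - 0) ^ Suc 1 / fact 1"
    by (rule complex_Taylor[of S 1 f]) (use der bd in \<open>auto simp: S_def\<close>)
  then show ?thesis
    by (simp add: f_def power2_eq_square algebra_simps)
qed

text \<open>
  The difference equals \<open>(x + u - 1/2) (Ln (x + u) - Ln x) - u\<close>, where \<open>Ln (x + u) - Ln x\<close>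
  is \<open>u / x + O(1 / \<bar>x\<bar>\<^sup>2)\<close>. The shift serves twice: with \<open>x = n\<close> it evaluates
  Euler's limit, and with \<open>x\<close> on a ray it accounts for the real offset in the argument of \<open>\<Gamma>\<close>.
\<close>

lemma tendsto_stirling_exponent_shift:
  assumes "filterlim f at_infinity F" "eventually (\<lambda>x. f x \<in> slit_cone \<kappa>) F" "\<kappa> > 0"
  shows "((\<lambda>x. stirling_exponent (f x + u) - stirling_exponent (f x) - u * Ln (f x)) \<longlongrightarrow> 0) F"
proof -
  define h where "h = (\<lambda>x. Ln (f x + u) - Ln (f x) - u / f x)"
  have inf: "filterlim (\<lambda>x. cmod (f x)) at_top F"
    by (rule filterlim_compose[OF filterlim_norm_at_top assms(1)])
  have big: "eventually (\<lambda>x. cmod (f x) \<ge> 2 * cmod u / \<kappa>) F"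
    using inf by (simp add: filterlim_at_top)
  have hb: "eventually (\<lambda>x. cmod (f x * h x) \<le> 4 * (cmod u)\<^sup>2 / cmod (f x)) F"
    using assms(2) big
  proof eventually_elim
    case (elim x)
    have u: "2 * cmod u \<le> \<kappa> * cmod (f x)"
      using elim(2) assms(3) by (simp add: field_simps)
    have x0: "cmod (f x) > 0" using elim(1) by (simp add: slit_cone_def)
    have "\<kappa> \<le> 1" using slit_coneD[OF elim(1), of 0] x0 by simp
    then have "\<kappa> * cmod (f x) \<le> cmod (f x)" using mult_right_mono[of \<kappa> 1 "cmod (f x)"] by simp
    then have u': "2 * cmod u \<le> cmod (f x)" using u by linarith
    have "cmod (h x) \<le> (cmod u)\<^sup>2 / (cmod (f x) / 2)\<^sup>2"
      unfolding h_def
    proof (rule norm_Ln_add_le)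
      fix v assume "v \<in> closed_segment 0 u"
      then have v: "cmod v \<le> cmod u"
        by (auto dest: segment_bound(1))
      have "f x + v \<in> slit_cone (\<kappa> / 3)"
        by (rule slit_cone_perturb[OF elim(1) assms(3)]) (use u v in linarith)
      then have "f x + v \<notin> \<real>\<^sub>\<le>\<^sub>0"
        by (rule slit_cone_not_nonpos_Reals) (use assms(3) in simp)
      moreover have "cmod (f x) / 2 \<le> cmod (f x + v)"
        using norm_triangle_ineq2[of "f x" "- v"] v u' by simp
      ultimately show "cmod (f x) / 2 \<le> cmod (f x + v) \<and> f x + v \<notin> \<real>\<^sub>\<le>\<^sub>0" by simp
    qed (use x0 in simp)
    then have "cmod (f x) * cmod (h x) \<le> cmod (f x) * ((cmod u)\<^sup>2 / (cmod (f x) / 2)\<^sup>2)"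
      by (rule mult_left_mono) simp
    also have "\<dots> = 4 * (cmod u)\<^sup>2 / cmod (f x)"
      using x0 by (simp add: field_simps power2_eq_square)
    finally show ?case by (simp add: norm_mult)
  qed
  have inv: "((\<lambda>x. c / f x) \<longlongrightarrow> 0) F" for c
    using tendsto_divide_0[OF tendsto_const assms(1)] .
  have "((\<lambda>x. 4 * (cmod u)\<^sup>2 / cmod (f x)) \<longlongrightarrow> 0) F"
    by (rule real_tendsto_divide_at_top[OF tendsto_const inf])
  with hb have xh: "((\<lambda>x. f x * h x) \<longlongrightarrow> 0) F"
    by (rule Lim_null_comparison)
  have "((\<lambda>x. f x * h x + (u - 1/2) * ((f x * h x) * (1 / f x)) + (u - 1/2) * u / f x)
      \<longlongrightarrow> 0 + (u - 1/2) * (0 * 0) + 0) F"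
    by (intro tendsto_intros xh inv)
  moreover have "eventually (\<lambda>x. f x * h x + (u - 1/2) * ((f x * h x) * (1 / f x)) + (u - 1/2) * u / f x
      = stirling_exponent (f x + u) - stirling_exponent (f x) - u * Ln (f x)) F"
    using assms(2)
  proof eventually_elim
    case (elim x)
    then have "f x \<noteq> 0" by (simp add: slit_cone_def)
    then show ?case
      by (simp add: h_def stirling_exponent_def field_simps)
  qed
  ultimately show ?thesis by (simp add: tendsto_cong)
qed

section \<open>Stirling's formula\<close>

lemma pochhammer_stirling:
  assumes "z \<in> slit_cone \<kappa>" "\<kappa> > 0"
  shows "pochhammer z n = exp (stirling_exponent (z + of_nat n) - stirling_exponent z
           - (\<Sum>k<n. stirling_defect (z + of_nat k)))"
proof (induction n)
  case (Suc n)
  have "z + of_nat n \<noteq> 0"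
    using slit_cone_add_nonneg[OF assms, of "real n"] by (simp add: slit_cone_def)
  then have "z + of_nat n = exp (Ln (z + of_nat n))"
    by simp
  also have "Ln (z + of_nat n) = stirling_exponent (z + of_nat (Suc n))
      - stirling_exponent (z + of_nat n) - stirling_defect (z + of_nat n)"
    by (simp add: stirling_defect_def add_ac)
  finally have "pochhammer z (Suc n) = exp (stirling_exponent (z + of_nat n) - stirling_exponent z
           - (\<Sum>k<n. stirling_defect (z + of_nat k))) * exp (stirling_exponent (z + of_nat (Suc n))
      - stirling_exponent (z + of_nat n) - stirling_defect (z + of_nat n))"
    unfolding pochhammer_Suc by (rule arg_cong2[where f = "(*)", OF Suc.IH])
  then show ?case
    by (simp add: algebra_simps flip: exp_add)
qed simp

lemma pos_real_in_slit_cone: "x > 0 \<Longrightarrow> of_real x \<in> slit_cone 1"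
  by (simp add: slit_cone_def flip: of_real_add)

text \<open>
  In Euler's limit \<open>n! n\<^sup>z / (z (z + 1) \<dots> (z + n))\<close> both the factorial, which is the Pochhammer
  product at \<open>1\<close>, and the denominator telescope. What remains of the Stirling exponents at
  \<open>n + 1\<close> and \<open>n + 1 + z\<close> cancels against \<open>n\<^sup>z\<close> in the limit.
\<close>

lemma Gamma_eq_binet_const:
  assumes "z \<in> slit_cone \<kappa>" "\<kappa> > 0"
  shows "Gamma z = exp (1 - binet_log 1) * exp (stirling_exponent z + binet_log z)"
proof -
  have one: "1 \<in> slit_cone 1" using pos_real_in_slit_cone[of 1] by simp
  have inf: "filterlim (\<lambda>n. of_nat n :: complex) at_infinity sequentially"
    by (rule tendsto_of_nat)
  have pos: "eventually (\<lambda>n. of_nat n \<in> slit_cone 1) sequentially"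
    using eventually_gt_at_top[of "0::nat"]
    by eventually_elim (use pos_real_in_slit_cone[of "real _"] in simp)
  note shift = tendsto_stirling_exponent_shift[OF inf pos zero_less_one]
  \<comment> \<open>Both leftover exponents are compared with the one at \<open>n\<close>, by the shifts \<open>1\<close> and \<open>z + 1\<close>;
     the two multiples of \<open>Ln n\<close> differ by \<open>z Ln n\<close>, as in Euler's limit.\<close>
  define e where "e = (\<lambda>u n. stirling_exponent (of_nat n + u) - stirling_exponent (of_nat n)
                                - u * Ln (of_nat n))"
  have part: "(\<lambda>n. \<Sum>k<n. stirling_defect (w + of_nat k)) \<longlonglongrightarrow> binet_log w"
    if "w \<in> slit_cone \<kappa>'" "\<kappa>' > 0" for w \<kappa>'
    unfolding binet_log_def using summable_LIMSEQ[OF summable_stirling_defect[OF that]] .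
  have "(\<lambda>n. exp (e 1 n - e (z + 1) n
            + (1 - (\<Sum>k<n. stirling_defect (1 + of_nat k)))
            + (stirling_exponent z + (\<Sum>k<Suc n. stirling_defect (z + of_nat k)))))
        \<longlonglongrightarrow> exp (0 - 0 + (1 - binet_log 1) + (stirling_exponent z + binet_log z))"
    unfolding e_def
    by (intro tendsto_intros shift part[OF one] LIMSEQ_Suc[OF part[OF assms]]) simp
  moreover have "eventually (\<lambda>n. exp (e 1 n - e (z + 1) n
            + (1 - (\<Sum>k<n. stirling_defect (1 + of_nat k)))
            + (stirling_exponent z + (\<Sum>k<Suc n. stirling_defect (z + of_nat k))))
        = Gamma_series z n) sequentially"
    using eventually_gt_at_top[of "0::nat"]
  proof eventually_elim
    case (elim n)
    have ln: "Ln (of_nat n) = of_real (ln (real n))"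
      using elim Ln_of_real[of "real n"] by simp
    have "fact n = exp (stirling_exponent (1 + of_nat n) + 1
                     - (\<Sum>k<n. stirling_defect (1 + of_nat k)))"
      unfolding pochhammer_fact pochhammer_stirling[OF one zero_less_one]
      by (simp add: stirling_exponent_def)
    then show ?case
      unfolding Gamma_series_def Suc_eq_plus1[symmetric] pochhammer_stirling[OF assms]
      by (simp add: e_def ln algebra_simps flip: exp_add exp_diff)
  qed
  ultimately have "Gamma_series z \<longlonglongrightarrow> exp (0 - 0 + (1 - binet_log 1) + (stirling_exponent z + binet_log z))"
    by (rule Lim_transform_eventually)
  from LIMSEQ_unique[OF Gamma_series_LIMSEQ this] show ?thesis
    by (simp add: exp_add)
qed

lemma asymp_equiv_Gamma_binet_const:
  assumes "filterlim f at_infinity F" "eventually (\<lambda>x. f x \<in> slit_cone \<kappa>) F" "\<kappa> > 0"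
  shows "(\<lambda>x. Gamma (f x + u)) \<sim>[F]
           (\<lambda>x. exp (1 - binet_log 1) * exp (stirling_exponent (f x) + u * Ln (f x)))"
proof (rule asymp_equivI'_const)
  have inf: "filterlim (\<lambda>x. cmod (f x)) at_top F"
    by (rule filterlim_compose[OF filterlim_norm_at_top assms(1)])
  have "eventually (\<lambda>x. cmod (f x) \<ge> 2 * cmod u / \<kappa>) F"
    using inf by (simp add: filterlim_at_top)
  with assms(2) have cone: "eventually (\<lambda>x. f x + u \<in> slit_cone (\<kappa> / 3)) F"
  proof eventually_elim
    case (elim x)
    then show ?case
      using assms(3) by (intro slit_cone_perturb) (auto simp: field_simps)
  qed
  have inf': "filterlim (\<lambda>x. f x + u) at_infinity F"
    by (rule tendsto_add_filterlim_at_infinity'[OF assms(1) tendsto_const])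
  have "((\<lambda>x. exp (1 - binet_log 1) * exp (binet_log (f x + u)
           + (stirling_exponent (f x + u) - stirling_exponent (f x) - u * Ln (f x))))
          \<longlongrightarrow> exp (1 - binet_log 1) * exp (0 + 0)) F"
    by (intro tendsto_intros tendsto_binet_log[OF inf' cone]
          tendsto_stirling_exponent_shift[OF assms]) (use assms(3) in simp)
  moreover have "eventually (\<lambda>x. exp (1 - binet_log 1) * exp (binet_log (f x + u)
           + (stirling_exponent (f x + u) - stirling_exponent (f x) - u * Ln (f x)))
        = Gamma (f x + u) / exp (stirling_exponent (f x) + u * Ln (f x))) F"
    using cone
  proof eventually_elim
    case (elim x)
    show ?case
      by (subst Gamma_eq_binet_const[OF elim])
        (use assms(3) in \<open>simp_all add: exp_add exp_diff field_simps\<close>)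
  qed
  ultimately show "((\<lambda>x. Gamma (f x + u) / exp (stirling_exponent (f x) + u * Ln (f x)))
          \<longlongrightarrow> exp (1 - binet_log 1)) F"
    by (simp add: tendsto_cong)
qed simp

text \<open>
  Inserting the asymptotics into \<open>\<Gamma>(x) \<Gamma>(x + 1/2) = 2 powr (1 - 2 x) \<surd>\<pi> \<Gamma>(2 x)\<close> for real
  \<open>x\<close>, the left-hand side contains the unknown constant twice and the right-hand side once, and
  everything that depends on \<open>x\<close> cancels.
\<close>

lemma exp_binet_const: "exp (1 - binet_log 1) = of_real (sqrt (2 * pi))"
proof -
  define C where "C = exp (1 - binet_log 1)"
  define S where "S = stirling_exponent"
  have inf: "filterlim (\<lambda>x. of_real x :: complex) at_infinity at_top"
    by (rule filterlim_of_real_at_infinity)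
  have cone: "eventually (\<lambda>x. of_real x \<in> slit_cone 1) at_top"
    using eventually_gt_at_top[of "0::real"] by eventually_elim (rule pos_real_in_slit_cone)
  note st = asymp_equiv_Gamma_binet_const[OF inf cone zero_less_one, folded C_def S_def]
  have dbl: "filterlim (\<lambda>x::real. 2 * x) at_top at_top" by real_asymp
  have left: "(\<lambda>x. Gamma (of_real x + 0) * Gamma (of_real x + 1/2)) \<sim>[at_top]
     (\<lambda>x. (C * exp (S (of_real x) + 0 * Ln (of_real x)))
         * (C * exp (S (of_real x) + 1/2 * Ln (of_real x))))"
    by (intro asymp_equiv_mult st)
  have right: "(\<lambda>x. exp ((1 - 2 * of_real x) * of_real (ln 2)) * of_real (sqrt pi)
        * Gamma (of_real (2 * x) + 0)) \<sim>[at_top]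
     (\<lambda>x. exp ((1 - 2 * of_real x) * of_real (ln 2)) * of_real (sqrt pi)
        * (C * exp (S (of_real (2 * x)) + 0 * Ln (of_real (2 * x)))))"
    by (intro asymp_equiv_mult asymp_equiv_refl asymp_equiv_compose'[OF st dbl])
  have duplication: "eventually (\<lambda>x. Gamma (of_real x + 0 :: complex) * Gamma (of_real x + 1/2) =
       exp ((1 - 2 * of_real x) * of_real (ln 2)) * of_real (sqrt pi)
        * Gamma (of_real (2 * x) + 0)) at_top"
    using eventually_gt_at_top[of "0::real"]
  proof eventually_elim
    case (elim x)
    have "of_real y \<notin> (\<int>\<^sub>\<le>\<^sub>0 :: complex set)" if "y > 0" for y
      using that by (auto elim!: nonpos_Ints_cases simp: complex_eq_iff)
    from this[of x] this[of "x + 1/2"] show ?case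
      using elim Gamma_legendre_duplication[of "of_real x"] by simp
  qed
  have eq: "(\<lambda>x. (C * exp (S (of_real x) + 0 * Ln (of_real x)))
         * (C * exp (S (of_real x) + 1/2 * Ln (of_real x)))) \<sim>[at_top]
     (\<lambda>x. exp ((1 - 2 * of_real x) * of_real (ln 2)) * of_real (sqrt pi)
        * (C * exp (S (of_real (2 * x)) + 0 * Ln (of_real (2 * x)))))"
    using asymp_equiv_trans[OF asymp_equiv_symI[OF left]
            asymp_equiv_trans[OF asymp_equiv_refl_ev[OF duplication] right]] .
  \<comment> \<open>the factor common to both sides once the exponents at \<open>x\<close> are rewritten at \<open>2 x\<close>\<close>
  define D where "D = (\<lambda>x. C * exp (S (of_real (2 * x)) + of_real (ln 2) * (1/2 - 2 * of_real x)))"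
  have D0: "D x \<noteq> 0" for x by (simp add: D_def C_def)
  have l: "eventually (\<lambda>x. (C * exp (S (of_real x) + 0 * Ln (of_real x)))
         * (C * exp (S (of_real x) + 1/2 * Ln (of_real x))) = C * D x) at_top"
    using eventually_gt_at_top[of "0::real"]
  proof eventually_elim
    case (elim x)
    have Ln_x: "Ln (of_real x) = of_real (ln x)"
      using elim by (rule Ln_of_real)
    have Ln_2x: "Ln (of_real (2 * x)) = of_real (ln 2) + of_real (ln x)"
      using elim by (subst Ln_of_real) (simp_all add: ln_mult)
    have "S (of_real x) + (S (of_real x) + 1/2 * Ln (of_real x)) =
       S (of_real (2 * x)) + of_real (ln 2) * (1/2 - 2 * of_real x)"
      unfolding S_def stirling_exponent_def Ln_x Ln_2x by (simp add: algebra_simps)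
    then show ?case by (simp add: D_def flip: exp_add)
  qed
  have r: "exp ((1 - 2 * of_real x) * of_real (ln 2)) * of_real (sqrt pi)
        * (C * exp (S (of_real (2 * x)) + 0 * Ln (of_real (2 * x)))) = of_real (sqrt (2*pi)) * D x" for x
  proof -
    have "of_real (sqrt 2) = exp (of_real (ln 2) / 2 :: complex)"
    proof -
      have "sqrt 2 = exp (ln 2 / 2)" by (simp add: powr_def flip: powr_half_sqrt)
      then show ?thesis by (simp flip: exp_of_real)
    qed
    then show ?thesis
      by (simp add: D_def real_sqrt_mult algebra_simps flip: exp_add)
  qed
  have "(\<lambda>x. C * D x) \<sim>[at_top] (\<lambda>x. of_real (sqrt (2*pi)) * D x)"
    by (rule asymp_equiv_transfer[OF eq l]) (intro always_eventually allI r)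
  then have "(\<lambda>x::real. C) \<sim>[at_top] (\<lambda>x. of_real (sqrt (2*pi)))"
    using asymp_equiv_divide[OF _ asymp_equiv_refl[of D]] D0 by fastforce
  then show ?thesis
    unfolding C_def by (auto dest!: asymp_equivD simp: tendsto_const_iff)
qed

section \<open>The modulus of the Gamma function along a ray\<close>

text \<open>
  The real part of \<open>S x + B Ln x\<close> for \<open>x = \<rho> e\<^sup>i\<^sup>\<theta>\<close>, with \<open>S\<close> the Stirling exponent.
\<close>

definition stirling_modulus_log :: "real \<Rightarrow> real \<Rightarrow> real \<Rightarrow> real" where
  "stirling_modulus_log \<theta> B \<rho> =
     (cos \<theta> * \<rho> + B - 1/2) * ln \<rho> - (cos \<theta> + \<theta> * sin \<theta>) * \<rho>"

lemma cmod_Gamma_ray_asymp_equiv: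
  assumes "\<bar>\<theta>\<bar> < pi"
  shows "(\<lambda>\<rho>. cmod (Gamma (of_real \<rho> * cis \<theta> + of_real B))) \<sim>[at_top]
           (\<lambda>\<rho>. sqrt (2 * pi) * exp (stirling_modulus_log \<theta> B \<rho>))"
proof -
  have "cos (\<theta> / 2) > 0" using assms by (intro cos_gt_zero_pi) auto
  moreover have "filterlim (\<lambda>\<rho>. of_real \<rho> * cis \<theta>) at_infinity at_top"
    by (rule filterlim_norm_at_top_imp_at_infinity)
       (simp add: norm_mult filterlim_abs_real)
  moreover have "eventually (\<lambda>\<rho>. of_real \<rho> * cis \<theta> \<in> slit_cone (cos (\<theta> / 2))) at_top"
    using eventually_gt_at_top[of 0] by eventually_elim (rule ray_in_slit_cone[OF assms])
  ultimately have st: "(\<lambda>\<rho>. cmod (Gamma (of_real \<rho> * cis \<theta> + of_real B))) \<sim>[at_top]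
     (\<lambda>\<rho>. cmod (exp (1 - binet_log 1) * exp (stirling_exponent (of_real \<rho> * cis \<theta>)
                   + of_real B * Ln (of_real \<rho> * cis \<theta>))))"
    by (intro asymp_equiv_norm asymp_equiv_Gamma_binet_const)
  have modulus: "eventually (\<lambda>\<rho>. cmod (exp (1 - binet_log 1) * exp (stirling_exponent (of_real \<rho> * cis \<theta>)
                   + of_real B * Ln (of_real \<rho> * cis \<theta>)))
        = sqrt (2 * pi) * exp (stirling_modulus_log \<theta> B \<rho>)) at_top"
    using eventually_gt_at_top[of 0]
  proof eventually_elim
    case (elim \<rho>)
    have "of_real \<rho> * cis \<theta> = exp (of_real (ln \<rho>) + \<i> * of_real \<theta>)"
      using elim by (simp add: exp_add cis_conv_exp exp_of_real)
    then have "Ln (of_real \<rho> * cis \<theta>) = of_real (ln \<rho>) + \<i> * of_real \<theta>"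
      using assms by (simp add: Ln_exp abs_less_iff)
    then have "Re (stirling_exponent (of_real \<rho> * cis \<theta>) + of_real B * Ln (of_real \<rho> * cis \<theta>))
        = stirling_modulus_log \<theta> B \<rho>"
      by (simp add: stirling_exponent_def stirling_modulus_log_def algebra_simps)
    then show ?case
      by (simp add: exp_binet_const norm_mult)
  qed
  show ?thesis
    by (rule asymp_equiv_transfer[OF st always_eventually modulus]) simp
qed

section \<open>Products of Gamma factors\<close>

lemma asymp_equiv_prod:
  fixes f g :: "'i \<Rightarrow> 'a \<Rightarrow> 'b :: real_normed_field"
  assumes "\<And>i. i \<in> A \<Longrightarrow> f i \<sim>[F] g i"
  shows "(\<lambda>x. \<Prod>i\<in>A. f i x) \<sim>[F] (\<lambda>x. \<Prod>i\<in>A. g i x)"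
  using assms
  by (induction A rule: infinite_finite_induct) (simp_all add: asymp_equiv_mult)

lemma cmod_Gamma_unreflected_factor:
  assumes "\<bar>\<theta>\<bar> < pi" "\<beta> > 0"
  shows "(\<lambda>R. cmod (Gamma (of_real b + (of_real \<gamma> + of_real R * cis \<theta>) * of_real \<beta>))) \<sim>[at_top]
           (\<lambda>R. sqrt (2 * pi) * exp (stirling_modulus_log \<theta> (b + \<beta> * \<gamma>) (\<beta> * R)))"
proof -
  have "filterlim (\<lambda>R. \<beta> * R) at_top at_top" using assms(2) by real_asymp
  from asymp_equiv_compose'[OF cmod_Gamma_ray_asymp_equiv[OF assms(1), of "b + \<beta> * \<gamma>"] this]
  show ?thesis by (simp add: algebra_simps)
qed

text \<open>
  Replacing \<open>\<theta>\<close> by \<open>\<theta> - sgn \<theta> \<pi>\<close> changes the sign of \<open>cos \<theta>\<close> and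
  \<open>sin \<theta>\<close>, and with \<open>B = a + \<alpha> \<gamma>\<close> the offset \<open>B - 1/2\<close> becomes
  \<open>1/2 - B\<close>. So the whole exponent changes sign, except for \<open>\<theta> sin \<theta>\<close>, whose first factor is also moved by \<open>\<pi>\<close>.
\<close>

lemma cmod_Gamma_reflected_factor:
  assumes "\<bar>\<theta>\<bar> < pi" "\<theta> \<noteq> 0" "\<alpha> > 0"
  shows "(\<lambda>R. cmod (Gamma (1 - of_real a - (of_real \<gamma> + of_real R * cis \<theta>) * of_real \<alpha>))) \<sim>[at_top]
           (\<lambda>R. sqrt (2 * pi) * exp (- stirling_modulus_log \<theta> (a + \<alpha> * \<gamma>) (\<alpha> * R)
                   - pi * (sgn \<theta> * sin \<theta>) * \<alpha> * R))"
proof -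
  define \<phi> where "\<phi> = \<theta> - sgn \<theta> * pi"
  have \<phi>: "\<bar>\<phi>\<bar> < pi" using assms(1,2) by (auto simp: \<phi>_def sgn_if abs_if split: if_splits)
  have cs: "cos \<phi> = - cos \<theta>" "sin \<phi> = - sin \<theta>"
    using assms(2) by (auto simp: \<phi>_def sgn_if)
  have cis: "cis \<phi> = - cis \<theta>" by (simp add: complex_eq_iff cs)
  have "filterlim (\<lambda>R. \<alpha> * R) at_top at_top" using assms(3) by real_asymp
  from asymp_equiv_compose'[OF cmod_Gamma_ray_asymp_equiv[OF \<phi>, of "1 - (a + \<alpha> * \<gamma>)"] this]
  have "(\<lambda>R. cmod (Gamma (1 - of_real a - (of_real \<gamma> + of_real R * cis \<theta>) * of_real \<alpha>))) \<sim>[at_top]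
      (\<lambda>R. sqrt (2 * pi) * exp (stirling_modulus_log \<phi> (1 - (a + \<alpha> * \<gamma>)) (\<alpha> * R)))"
    by (simp add: cis algebra_simps)
  moreover have "stirling_modulus_log \<phi> (1 - (a + \<alpha> * \<gamma>)) (\<alpha> * R) =
      - stirling_modulus_log \<theta> (a + \<alpha> * \<gamma>) (\<alpha> * R) - pi * (sgn \<theta> * sin \<theta>) * \<alpha> * R" for R
    by (simp add: stirling_modulus_log_def cs) (simp add: \<phi>_def algebra_simps)
  ultimately show ?thesis by simp
qed

lemma sum_stirling_modulus_log:
  assumes "R > 0" "\<And>j. j \<in> {1..N} \<Longrightarrow> \<beta> j > 0"
  shows "(\<Sum>j=1..N. stirling_modulus_log \<theta> (b j + \<beta> j * \<gamma>) (\<beta> j * R)) =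
     cos \<theta> * (\<Sum>j=1..N. \<beta> j) * R * ln R
     + (cos \<theta> * (\<Sum>j=1..N. \<beta> j * ln (\<beta> j)) - (cos \<theta> + \<theta> * sin \<theta>) * (\<Sum>j=1..N. \<beta> j)) * R
     + ((\<Sum>j=1..N. b j) + \<gamma> * (\<Sum>j=1..N. \<beta> j) - real N / 2) * ln R
     + (\<Sum>j=1..N. (b j + \<beta> j * \<gamma> - 1/2) * ln (\<beta> j))"
proof -
  have "(\<Sum>j=1..N. stirling_modulus_log \<theta> (b j + \<beta> j * \<gamma>) (\<beta> j * R)) =
    (\<Sum>j=1..N. cos \<theta> * R * ln R * \<beta> j + cos \<theta> * R * (\<beta> j * ln (\<beta> j))
       - (cos \<theta> + \<theta> * sin \<theta>) * R * \<beta> j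
       + (ln R * b j + \<gamma> * ln R * \<beta> j - ln R / 2) + (b j + \<beta> j * \<gamma> - 1/2) * ln (\<beta> j))"
  proof (rule sum.cong[OF refl])
    fix j assume "j \<in> {1..N}"
    then have "ln (\<beta> j * R) = ln (\<beta> j) + ln R"
      using assms by (intro ln_mult_pos) auto
    then show "stirling_modulus_log \<theta> (b j + \<beta> j * \<gamma>) (\<beta> j * R) =
       cos \<theta> * R * ln R * \<beta> j + cos \<theta> * R * (\<beta> j * ln (\<beta> j))
       - (cos \<theta> + \<theta> * sin \<theta>) * R * \<beta> j
       + (ln R * b j + \<gamma> * ln R * \<beta> j - ln R / 2) + (b j + \<beta> j * \<gamma> - 1/2) * ln (\<beta> j)"
      by (simp add: stirling_modulus_log_def algebra_simps)
  qed
  also have "\<dots> = cos \<theta> * R * ln R * (\<Sum>j=1..N. \<beta> j) + cos \<theta> * R * (\<Sum>j=1..N. \<beta> j * ln (\<beta> j))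
       - (cos \<theta> + \<theta> * sin \<theta>) * R * (\<Sum>j=1..N. \<beta> j)
       + (ln R * (\<Sum>j=1..N. b j) + \<gamma> * ln R * (\<Sum>j=1..N. \<beta> j) - real N * (ln R / 2))
       + (\<Sum>j=1..N. (b j + \<beta> j * \<gamma> - 1/2) * ln (\<beta> j))"
    by (simp add: sum.distrib sum_subtractf flip: sum_distrib_left)
  finally show ?thesis by (simp add: algebra_simps)
qed

lemma prod_powr_eq_exp_sum:
  assumes "\<And>j. j \<in> A \<Longrightarrow> \<beta> j > (0::real)"
  shows "(\<Prod>j\<in>A. \<beta> j powr e j) = exp (\<Sum>j\<in>A. e j * ln (\<beta> j))"
proof (cases "finite A")
  case True
  then show ?thesis using assms
    by (simp add: exp_sum powr_def less_imp_neq[symmetric] cong: prod.cong)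
qed simp

lemma sum_split_at:
  fixes f :: "nat \<Rightarrow> real"
  assumes "m \<le> q"
  shows "(\<Sum>j=1..q. f j) = (\<Sum>j=1..m. f j) + (\<Sum>j=m+1..q. f j)"
  using sum.ub_add_nat[of 1 m f "q - m"] assms by simp

section \<open>The asymptotics of the kernel\<close>

theorem lemma1:
  fixes m n p q :: nat
    and a \<alpha> b \<beta> :: "nat \<Rightarrow> real"
    and \<gamma> \<theta> :: real
    and z :: complex
    and L :: "real \<Rightarrow> complex"
  assumes "m \<le> q" and "n \<le> p"
    and "\<And>i. i \<in> {1..p} \<Longrightarrow> \<alpha> i > 0"
    and "\<And>j. j \<in> {1..q} \<Longrightarrow> \<beta> j > 0"
    and "vertical_contour \<gamma> L"
    and "\<And>j l. j \<in> {1..m} \<Longrightarrow>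
           complex_of_real (- ((b j + real l) / \<beta> j)) \<in> left_of_contour L"
    and "\<And>i k. i \<in> {1..n} \<Longrightarrow>
           complex_of_real ((1 - a i + real k) / \<alpha> i) \<in> right_of_contour L"
    and "\<theta> \<in> {-pi<..<pi} - {0}"
    and "z \<noteq> 0"
  shows "asymp_equiv
           (\<lambda>R::real. let s = complex_of_real \<gamma> + complex_of_real R * exp (\<i> * complex_of_real \<theta>)
                      in cmod (H_kernel m n p q a \<alpha> b \<beta> s * z powr (- s)))
           at_top
           (\<lambda>R. H_const m n p q a \<alpha> b \<beta> \<gamma> z *
                exp (H_Upsilon1 p q \<alpha> \<beta> \<theta> * R * ln R
                     - H_Upsilon2 m n p q \<alpha> \<beta> z \<theta> * R
                     + H_Upsilon3 p q a \<alpha> b \<beta> \<gamma> * ln R))"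
proof -
  have \<theta>: "\<bar>\<theta>\<bar> < pi" "\<theta> \<noteq> 0" using assms(8) by auto
  define K where "K = sqrt (2 * pi)"
  define \<sigma> where "\<sigma> = pi * (sgn \<theta> * sin \<theta>)"
  define M where "M = (\<lambda>j R. stirling_modulus_log \<theta> (b j + \<beta> j * \<gamma>) (\<beta> j * R))"
  define M' where "M' = (\<lambda>i R. stirling_modulus_log \<theta> (a i + \<alpha> i * \<gamma>) (\<alpha> i * R))"
  define s where "s = (\<lambda>R. complex_of_real \<gamma> + of_real R * cis \<theta>)"
  define Z where "Z = (\<lambda>R. cmod z powr (- \<gamma>) * exp (- R * (cos \<theta> * ln (cmod z) + sin \<theta> * (- Arg z))))"
  note num = cmod_Gamma_unreflected_factor[OF \<theta>(1), where \<gamma> = \<gamma>, folded K_def]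
  note ref = cmod_Gamma_reflected_factor[OF \<theta>, where \<gamma> = \<gamma>, folded K_def \<sigma>_def]
  have equiv: "(\<lambda>R. ((\<Prod>j=1..m. cmod (Gamma (of_real (b j) + s R * of_real (\<beta> j)))) *
      (\<Prod>i=1..n. cmod (Gamma (1 - of_real (a i) - s R * of_real (\<alpha> i))))) /
     ((\<Prod>i=n+1..p. cmod (Gamma (of_real (a i) + s R * of_real (\<alpha> i)))) *
      (\<Prod>j=m+1..q. cmod (Gamma (1 - of_real (b j) - s R * of_real (\<beta> j))))) * Z R)
    \<sim>[at_top] (\<lambda>R. ((\<Prod>j=1..m. K * exp (M j R)) * (\<Prod>i=1..n. K * exp (- M' i R - \<sigma> * \<alpha> i * R))) /
     ((\<Prod>i=n+1..p. K * exp (M' i R)) * (\<Prod>j=m+1..q. K * exp (- M j R - \<sigma> * \<beta> j * R))) * Z R)"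
    (is "?f \<sim>[_] ?g")
    unfolding M_def M'_def s_def using assms(1,2)
    by (intro asymp_equiv_mult asymp_equiv_divide asymp_equiv_prod num ref asymp_equiv_refl)
       (auto intro!: assms(3,4))
  have kernel: "?f R = (let s = complex_of_real \<gamma> + complex_of_real R * exp (\<i> * complex_of_real \<theta>)
                      in cmod (H_kernel m n p q a \<alpha> b \<beta> s * z powr (- s)))" for R
    unfolding Let_def H_kernel_def cis_conv_exp[symmetric] Z_def s_def
      norm_mult norm_divide norm_powr_minus_ray[OF assms(9)] prod_norm[symmetric] ..
  have exponents: "eventually (\<lambda>R. ?g R = H_const m n p q a \<alpha> b \<beta> \<gamma> z *
                exp (H_Upsilon1 p q \<alpha> \<beta> \<theta> * R * ln R
                     - H_Upsilon2 m n p q \<alpha> \<beta> z \<theta> * R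
                     + H_Upsilon3 p q a \<alpha> b \<beta> \<gamma> * ln R)) at_top"
    using eventually_gt_at_top[of 0]
  proof eventually_elim
    case (elim R)
    define W where "W = (2 * pi) powr (real m + real n - (real p + real q) / 2)"
    define Eb where "Eb = (\<Sum>j=1..q. (b j + \<beta> j * \<gamma> - 1/2) * ln (\<beta> j))"
    define Ea where "Ea = (\<Sum>i=1..p. (a i + \<alpha> i * \<gamma> - 1/2) * ln (\<alpha> i))"
    \<comment> \<open>There are \<open>m + n\<close> Gamma factors above and \<open>p - n + q - m\<close> below, each contributing \<open>\<surd>(2 \<pi>)\<close>.\<close>
    have K: "K ^ k = (2 * pi) powr (real k / 2)" for k
      unfolding K_def by (simp add: powr_half_sqrt[symmetric] powr_powr flip: powr_realpow)
    have W: "K ^ m * K ^ n / (K ^ (p - n) * K ^ (q - m)) = W"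
      unfolding K W_def using assms(1,2)
      by (simp add: of_nat_diff diff_divide_distrib add_divide_distrib flip: powr_add powr_diff)
        (simp add: algebra_simps)
    have "?g R = (K ^ m * K ^ n / (K ^ (p - n) * K ^ (q - m))) *
        (exp (\<Sum>j=1..m. M j R) * exp (\<Sum>i=1..n. - M' i R - \<sigma> * \<alpha> i * R) /
        (exp (\<Sum>i=n+1..p. M' i R) * exp (\<Sum>j=m+1..q. - M j R - \<sigma> * \<beta> j * R))) * Z R"
      by (simp add: prod.distrib exp_sum mult_ac)
    \<comment> \<open>A reflected factor in the denominator acts like an unreflected one in the numerator and
       vice versa, so the ranges \<open>1..m\<close>, \<open>m+1..q\<close> and \<open>1..n\<close>, \<open>n+1..p\<close> merge.\<close>
    also have "exp (\<Sum>j=1..m. M j R) * exp (\<Sum>i=1..n. - M' i R - \<sigma> * \<alpha> i * R) /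
        (exp (\<Sum>i=n+1..p. M' i R) * exp (\<Sum>j=m+1..q. - M j R - \<sigma> * \<beta> j * R))
      = exp ((\<Sum>j=1..q. M j R) - (\<Sum>i=1..p. M' i R) - \<sigma> * a2_star m n q \<alpha> \<beta> * R)"
      unfolding sum_split_at[OF assms(1)] sum_split_at[OF assms(2)] a2_star_def
      by (simp add: sum_subtractf sum_negf sum_distrib_left sum_distrib_right algebra_simps
            flip: exp_add exp_diff)
    finally have g: "?g R = W * exp ((\<Sum>j=1..q. M j R) - (\<Sum>i=1..p. M' i R)
                          - \<sigma> * a2_star m n q \<alpha> \<beta> * R) * Z R"
      unfolding W .
    have \<beta>_prod: "(\<Prod>j=1..q. \<beta> j powr e j) = exp (\<Sum>j=1..q. e j * ln (\<beta> j))" for e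
      by (rule prod_powr_eq_exp_sum) (rule assms(4))
    have \<alpha>_prod: "(\<Prod>i=1..p. \<alpha> i powr e i) = exp (\<Sum>i=1..p. e i * ln (\<alpha> i))" for e
      by (rule prod_powr_eq_exp_sum) (rule assms(3))
    have const: "H_const m n p q a \<alpha> b \<beta> \<gamma> z = cmod z powr (- \<gamma>) * W * exp (Eb - Ea)"
      unfolding H_const_def W_def Eb_def Ea_def exp_diff \<beta>_prod \<alpha>_prod
      by (simp add: mult_ac)
    have lndelta: "ln (H_delta p q \<alpha> \<beta>) = (\<Sum>j=1..q. \<beta> j * ln (\<beta> j)) - (\<Sum>i=1..p. \<alpha> i * ln (\<alpha> i))"
      and deltapos: "H_delta p q \<alpha> \<beta> > 0"
      unfolding H_delta_def \<beta>_prod \<alpha>_prod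
      by (simp_all add: sum_negf mult_ac flip: exp_add)
    have lnz: "ln (exp (H_Delta p q \<alpha> \<beta>) * cmod z / H_delta p q \<alpha> \<beta>) =
        H_Delta p q \<alpha> \<beta> + ln (cmod z) - ((\<Sum>j=1..q. \<beta> j * ln (\<beta> j)) - (\<Sum>i=1..p. \<alpha> i * ln (\<alpha> i)))"
      using deltapos assms(9) by (simp add: ln_div ln_mult lndelta)
    have a1: "a1_star m n p \<alpha> \<beta> = H_Delta p q \<alpha> \<beta> + a2_star m n q \<alpha> \<beta>"
      using H_Delta_eq[OF assms(1,2)] by simp
    have Theta: "H_Theta m n p q \<alpha> \<beta> z \<theta> = H_Delta p q \<alpha> \<beta> * \<theta>
                    + a2_star m n q \<alpha> \<beta> * (pi * sgn \<theta>) - Arg z"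
      unfolding H_Theta_def a1 by (simp add: sgn_if algebra_simps)
    have SM: "(\<Sum>j=1..q. M j R) =
       cos \<theta> * (\<Sum>j=1..q. \<beta> j) * R * ln R
     + (cos \<theta> * (\<Sum>j=1..q. \<beta> j * ln (\<beta> j)) - (cos \<theta> + \<theta> * sin \<theta>) * (\<Sum>j=1..q. \<beta> j)) * R
     + ((\<Sum>j=1..q. b j) + \<gamma> * (\<Sum>j=1..q. \<beta> j) - real q / 2) * ln R + Eb"
      unfolding M_def Eb_def by (rule sum_stirling_modulus_log[OF elim assms(4)])
    have SM': "(\<Sum>i=1..p. M' i R) =
       cos \<theta> * (\<Sum>i=1..p. \<alpha> i) * R * ln R
     + (cos \<theta> * (\<Sum>i=1..p. \<alpha> i * ln (\<alpha> i)) - (cos \<theta> + \<theta> * sin \<theta>) * (\<Sum>i=1..p. \<alpha> i)) * R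
     + ((\<Sum>i=1..p. a i) + \<gamma> * (\<Sum>i=1..p. \<alpha> i) - real p / 2) * ln R + Ea"
      unfolding M'_def Ea_def by (rule sum_stirling_modulus_log[OF elim assms(3)])
    have "(\<Sum>j=1..q. M j R) - (\<Sum>i=1..p. M' i R) - \<sigma> * a2_star m n q \<alpha> \<beta> * R
           - R * (cos \<theta> * ln (cmod z) + sin \<theta> * (- Arg z)) =
        Eb - Ea + (H_Upsilon1 p q \<alpha> \<beta> \<theta> * R * ln R
                     - H_Upsilon2 m n p q \<alpha> \<beta> z \<theta> * R
                     + H_Upsilon3 p q a \<alpha> b \<beta> \<gamma> * ln R)"
      unfolding SM SM' H_Upsilon1_def H_Upsilon2_def H_Upsilon3_def lnz Theta
      unfolding H_mu_def \<sigma>_def H_Delta_def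
      by (simp add: algebra_simps diff_divide_distrib)
    then have exps: "exp ((\<Sum>j=1..q. M j R) - (\<Sum>i=1..p. M' i R) - \<sigma> * a2_star m n q \<alpha> \<beta> * R)
          * exp (- R * (cos \<theta> * ln (cmod z) + sin \<theta> * (- Arg z))) =
        exp (Eb - Ea) * exp (H_Upsilon1 p q \<alpha> \<beta> \<theta> * R * ln R
                     - H_Upsilon2 m n p q \<alpha> \<beta> z \<theta> * R
                     + H_Upsilon3 p q a \<alpha> b \<beta> \<gamma> * ln R)"
      unfolding exp_add[symmetric] by simp
    show ?case
      unfolding g const
      unfolding Z_def using arg_cong[OF exps, of "\<lambda>t. cmod z powr (- \<gamma>) * W * t"]
      by (simp only: mult_ac)
  qed
  show ?thesis
    by (rule asymp_equiv_transfer[OF equiv _ exponents]) (intro always_eventually allI kernel)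
qed

end
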